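(* For any $t\in\mathbb{C}$ and $f(\xi,z)\in\mathbb{C}[\xi,z]$, the map $(\Phi_t)_*$ sends the multiplication operator of $\mathcal{B}_t[\xi,z]$ by $f(\xi,z)$ (with respect to the product $\ast_t$) to the multiplication operator of $\mathcal{A}[\xi,z]$ by $\Phi_t(f(\xi,z))$ (with respect to the product of $\mathcal{A}[\xi,z]$).
   Context: Let $\xi=(\xi_1,\dots,\xi_n)$ and $z=(z_1,\dots,z_n)$ be $2n$ commuting free variables, $\partial_i=\partial/\partial z_i$, $\delta_i=\partial/\partial \xi_i$. $\mathcal{A}[\xi,z]$ is the vector space $\mathbb{C}[\xi,z]$ with the usual polynomial multiplication. For $t\in\mathbb{C}$, $\mathcal{B}_t[\xi,z]$ is the vector space $\mathbb{C}[\xi,z]$ with the product $f\ast_t g:=\mu\big(e^{-t\Omega}(f\otimes g)\big)$, where $\Omega=\sum_{i=1}^n(\partial_i\otimes\delta_i+\delta_i\otimes\partial_i)$ and $\mu(f\otimes g)=fg$ is the usual multiplication. Let $\Lambda:=\sum_{i=1}^n\delta_i\partial_i$ and $\Phi_t:=e^{t\Lambda}=\sum_{m\ge0}\frac{t^m\Lambda^m}{m!}$, an algebra isomorphism $\mathcal{B}_t[\xi,z]\to\mathcal{A}[\xi,z]$ with inverse $\Phi_{-t}$. Let $\mathcal{D}_t[\xi,z]$ (resp. $\mathcal{D}[\xi,z]$) be the Weyl algebra of $\mathcal{B}_t[\xi,z]$ (resp. $\mathcal{A}[\xi,z]$), i.e. the associative algebra of linear endomorphisms of $\mathbb{C}[\xi,z]$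 generated by the $\mathbb{C}$-derivations and the multiplication operators of the given algebra. The induced isomorphism $(\Phi_t)_*:\mathcal{D}_t[\xi,z]\to\mathcal{D}[\xi,z]$ is $(\Phi_t)_*(\psi)=\Phi_t\circ\psi\circ\Phi_t^{-1}=\Phi_t\circ\psi\circ\Phi_{-t}$. *)

theory Defs
  imports Complex_Main "HOL-Library.Poly_Mapping" "HOL-Library.FuncSet"
begin

definition scale :: "complex \<Rightarrow> ('a \<Rightarrow>\<^sub>0 complex) \<Rightarrow> ('a \<Rightarrow>\<^sub>0 complex)" where
  "scale c p = Poly_Mapping.map ((*) c) p"

lemma lookup_scale: "Poly_Mapping.lookup (scale c p) a = c * Poly_Mapping.lookup p a"
  by (simp add: scale_def Poly_Mapping.map.rep_eq when_def)

lemma vector_space_scale: "vector_space (scale :: complex \<Rightarrow> ('a \<Rightarrow>\<^sub>0 complex) \<Rightarrow> ('a \<Rightarrow>\<^sub>0 complex))"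
  by unfold_locales (auto intro!: poly_mapping_eqI simp: lookup_scale lookup_add algebra_simps)

definition lin_ext :: "('a \<Rightarrow> ('b \<Rightarrow>\<^sub>0 complex)) \<Rightarrow> ('a \<Rightarrow>\<^sub>0 complex) \<Rightarrow> ('b \<Rightarrow>\<^sub>0 complex)" where
  "lin_ext h p = (\<Sum>a\<in>Poly_Mapping.keys p. scale (Poly_Mapping.lookup p a) (h a))"

text \<open>
  The operator \<open>exp (c T) = (\<Sum>m\<ge>0. c ^ m T ^ m / m!)\<close> for locally nilpotent \<open>T\<close>: on each vector only
  finitely many terms are nonzero, so the sum is a finite one. (\<open>Sum_any\<close> would be \<open>0\<close> on
  vectors where infinitely many terms are nonzero; this does not occur for the differential
  operators below, which lower the polynomial degree.)
\<close>

definition exp_op :: "complex \<Rightarrow> (('a \<Rightarrow>\<^sub>0 complex) \<Rightarrow> ('a \<Rightarrow>\<^sub>0 complex)) \<Rightarrow> ('a \<Rightarrow>\<^sub>0 complex) \<Rightarrow> ('a \<Rightarrow>\<^sub>0 complex)"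
  where "exp_op c T v = Sum_any (\<lambda>m. scale (c ^ m / fact m) ((T ^^ m) v))"

text \<open>
  The type \<open>'n\<close> is the index set of the two families of variables. A monomial is its finitely supported
  exponent vector, and multiplication of finitely supported functions on monomials is the
  convolution product, i.e. the usual product of polynomials.
\<close>

datatype 'n var = Xi 'n | Z 'n

type_synonym 'n mon = "'n var \<Rightarrow>\<^sub>0 nat"
type_synonym 'n cpoly = "'n mon \<Rightarrow>\<^sub>0 complex"

text \<open>
  Partial derivative in the variable \<open>v\<close>. The subtraction of exponents truncates only when the
  exponent of \<open>v\<close> is \<open>0\<close>, where the scalar factor vanishes.
\<close>

definition pderivative :: "'n var \<Rightarrow> 'n cpoly \<Rightarrow> 'n cpoly" where
  "pderivative v = lin_ext (\<lambda>a. scale (of_nat (Poly_Mapping.lookup a v)) (Poly_Mapping.single (a - Poly_Mapping.single v 1) 1))"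

abbreviation del_z :: "'n \<Rightarrow> 'n cpoly \<Rightarrow> 'n cpoly" where
  "del_z i \<equiv> pderivative (Z i)"

abbreviation del_xi :: "'n \<Rightarrow> 'n cpoly \<Rightarrow> 'n cpoly" where
  "del_xi i \<equiv> pderivative (Xi i)"

text \<open>
  Since monomials form a basis of the polynomials, pairs of monomials form a basis of the tensor square;
  the basis vector \<open>single (a, b) 1\<close> stands for the tensor of the monomials \<open>a\<close> and \<open>b\<close>.
\<close>

type_synonym 'n cpoly2 = "('n mon \<times> 'n mon) \<Rightarrow>\<^sub>0 complex"

definition tensor :: "'n cpoly \<Rightarrow> 'n cpoly \<Rightarrow> 'n cpoly2" where
  "tensor f g = (\<Sum>a\<in>Poly_Mapping.keys f. \<Sum>b\<in>Poly_Mapping.keys g. Poly_Mapping.single (a, b) (Poly_Mapping.lookup f a * Poly_Mapping.lookup g b))"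

definition tensor_op :: "('n cpoly \<Rightarrow> 'n cpoly) \<Rightarrow> ('n cpoly \<Rightarrow> 'n cpoly) \<Rightarrow> 'n cpoly2 \<Rightarrow> 'n cpoly2" where
  "tensor_op S T = lin_ext (\<lambda>(a, b). tensor (S (Poly_Mapping.single a 1)) (T (Poly_Mapping.single b 1)))"

definition mu :: "'n cpoly2 \<Rightarrow> 'n cpoly" where
  "mu = lin_ext (\<lambda>(a, b). Poly_Mapping.single a 1 * Poly_Mapping.single b 1)"

definition Omega :: "'n::finite cpoly2 \<Rightarrow> 'n cpoly2" where
  "Omega w = (\<Sum>i\<in>UNIV. tensor_op (del_z i) (del_xi i) w + tensor_op (del_xi i) (del_z i) w)"

definition star :: "complex \<Rightarrow> 'n::finite cpoly \<Rightarrow> 'n cpoly \<Rightarrow> 'n cpoly" where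
  "star t f g = mu (exp_op (- t) Omega (tensor f g))"

definition Lam :: "'n::finite cpoly \<Rightarrow> 'n cpoly" where
  "Lam f = (\<Sum>i\<in>UNIV. del_xi i (del_z i f))"

definition Phi :: "complex \<Rightarrow> 'n::finite cpoly \<Rightarrow> 'n cpoly" where
  "Phi t = exp_op t Lam"

text \<open>Below, \<open>m\<close> is the product of an algebra structure on the vector space of polynomials.\<close>

definition mult_op :: "('n cpoly \<Rightarrow> 'n cpoly \<Rightarrow> 'n cpoly) \<Rightarrow> 'n cpoly \<Rightarrow> 'n cpoly \<Rightarrow> 'n cpoly" where
  "mult_op m f = (\<lambda>g. m f g)"

definition derivation :: "('n cpoly \<Rightarrow> 'n cpoly \<Rightarrow> 'n cpoly) \<Rightarrow> ('n cpoly \<Rightarrow> 'n cpoly) \<Rightarrow> bool" where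
  "derivation m D \<longleftrightarrow>
     Vector_Spaces.linear scale scale D \<and> (\<forall>f g. D (m f g) = m (D f) g + m f (D g))"

text \<open>No rule for the identity is needed: it is the multiplication operator of the unit.\<close>

inductive_set weyl_algebra :: "('n cpoly \<Rightarrow> 'n cpoly \<Rightarrow> 'n cpoly) \<Rightarrow> ('n cpoly \<Rightarrow> 'n cpoly) set"
  for m :: "'n cpoly \<Rightarrow> 'n cpoly \<Rightarrow> 'n cpoly" where
  deriv: "derivation m D \<Longrightarrow> D \<in> weyl_algebra m"
| mult: "mult_op m f \<in> weyl_algebra m"
| add: "S \<in> weyl_algebra m \<Longrightarrow> T \<in> weyl_algebra m \<Longrightarrow> (\<lambda>g. S g + T g) \<in> weyl_algebra m"
| smult: "S \<in> weyl_algebra m \<Longrightarrow> (\<lambda>g. scale c (S g)) \<in> weyl_algebra m"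
| comp: "S \<in> weyl_algebra m \<Longrightarrow> T \<in> weyl_algebra m \<Longrightarrow> S \<circ> T \<in> weyl_algebra m"

text \<open>The induced map on the Weyl algebra of \<open>star t\<close>; it is left undefined outside this domain.\<close>

definition Phi_push :: "complex \<Rightarrow> ('n::finite cpoly \<Rightarrow> 'n cpoly) \<Rightarrow> ('n cpoly \<Rightarrow> 'n cpoly)" where
  "Phi_push t = (\<lambda>\<psi>\<in>weyl_algebra (star t). Phi t \<circ> \<psi> \<circ> inv (Phi t))"

end

theory Submission imports Defs begin

text \<open>
  Write \<open>\<Phi> = Phi t\<close>. Since multiplication by \<open>f\<close> in the star algebra is pushed forward to
  \<open>g \<mapsto> \<Phi> (star t f (\<Phi>\<inverse> g))\<close>, the claim amounts to two facts: \<open>\<Phi>\<close> is surjective, so that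
  \<open>\<Phi> (\<Phi>\<inverse> g) = g\<close> (\<open>Phi_inv\<close>), and \<open>\<Phi> (star t f g) = \<Phi> f * \<Phi> g\<close> (\<open>Phi_star\<close>).

  The reason for the second is the second-order Leibniz rule \<open>Lam_mu\<close>: on the tensor square,
  \<open>Lam \<circ> mu = mu \<circ> (Lam \<otimes> 1 + 1 \<otimes> Lam + Omega)\<close>, where \<open>Omega\<close> collects the mixed terms in which
  the two derivatives hit different factors. Exponentiating,
  \<open>exp (t Lam) \<circ> mu = mu \<circ> exp (t (Lam \<otimes> 1 + 1 \<otimes> Lam + Omega))\<close>. The three summands commute, because
  partial derivatives do, so the exponential on the right factors. Applied to
  \<open>exp (- t Omega) (f \<otimes> g)\<close> the factor \<open>exp (t Omega)\<close> cancels, and what is left is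
  \<open>mu (exp (t Lam) f \<otimes> exp (t Lam) g) = \<Phi> f * \<Phi> g\<close>.

  All exponentials are finite sums on each vector, as every operator involved strictly lowers the
  degree. The three formal rules that are needed, namely compatibility with intertwining maps,
  \<open>exp (S + T) = exp S \<circ> exp T\<close> for commuting operators, and \<open>exp T \<circ> exp (- T) = 1\<close>, are
  \<open>exp_op_intertwine\<close>, \<open>exp_op_plus\<close> and \<open>exp_op_cancel\<close>.
\<close>

section \<open>Linear maps between spaces with a distinguished basis\<close>

abbreviation lin :: "(('a \<Rightarrow>\<^sub>0 complex) \<Rightarrow> ('b \<Rightarrow>\<^sub>0 complex)) \<Rightarrow> bool" where
  "lin \<equiv> Vector_Spaces.linear scale scale"

lemma linI:
  assumes "\<And>p q. T (p + q) = T p + T q" "\<And>c p. T (scale c p) = scale c (T p)"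
  shows "lin T"
  using assms vector_space_scale vector_space_scale by (simp add: Vector_Spaces.linear_iff)

lemma lin_add: "lin T \<Longrightarrow> T (p + q) = T p + T q"
  and lin_scale: "lin T \<Longrightarrow> T (scale c p) = scale c (T p)"
  by (simp_all add: Vector_Spaces.linear_iff)

lemma scale_simps [simp]:
  "scale 0 p = 0" "scale 1 p = p" "scale c 0 = 0" "scale c (scale d p) = scale (c * d) p"
  "scale c (Poly_Mapping.single a x) = Poly_Mapping.single a (c * x)"
  by (auto intro!: poly_mapping_eqI simp: lookup_scale lookup_single when_def)

lemma scale_add_right: "scale c (p + q) = scale c p + scale c q"
  and scale_add_left: "scale (c + d) p = scale c p + scale d p"
  by (auto intro!: poly_mapping_eqI simp: lookup_scale lookup_add algebra_simps)

lemma scale_sum: "scale c (\<Sum>i\<in>I. p i) = (\<Sum>i\<in>I. scale c (p i))"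
  by (induction I rule: infinite_finite_induct) (auto simp: scale_add_right)

lemma lin_zero: "lin T \<Longrightarrow> T 0 = 0"
  using lin_scale[of T 0 0] by simp

lemma lin_sum: "lin T \<Longrightarrow> T (\<Sum>i\<in>I. p i) = (\<Sum>i\<in>I. T (p i))"
  by (induction I rule: infinite_finite_induct) (auto simp: lin_zero lin_add)

lemma lin_comp: "lin S \<Longrightarrow> lin T \<Longrightarrow> lin (\<lambda>p. S (T p))"
  by (auto intro!: linI simp: lin_add lin_scale)

lemma lin_plus: "lin S \<Longrightarrow> lin T \<Longrightarrow> lin (\<lambda>p. S p + T p)"
  by (auto intro!: linI simp: lin_add lin_scale scale_add_right)

lemma lin_Sum: "(\<And>i. i \<in> I \<Longrightarrow> lin (T i)) \<Longrightarrow> lin (\<lambda>p. \<Sum>i\<in>I. T i p)"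
  by (rule linI) (simp_all add: lin_add lin_scale sum.distrib scale_sum)

lemma lin_id: "lin (\<lambda>p. p)"
  by (rule linI) auto

lemma lin_funpow:
  fixes T :: "('a \<Rightarrow>\<^sub>0 complex) \<Rightarrow> ('a \<Rightarrow>\<^sub>0 complex)"
  shows "lin T \<Longrightarrow> lin (T ^^ n)"
  by (induction n) (simp_all add: lin_comp lin_id o_def id_def)

lemma lin_ext_superset:
  assumes "finite A" "Poly_Mapping.keys p \<subseteq> A"
  shows "lin_ext h p = (\<Sum>a\<in>A. scale (Poly_Mapping.lookup p a) (h a))"
  unfolding lin_ext_def
  by (rule sum.mono_neutral_left) (use assms in \<open>auto simp: in_keys_iff\<close>)

lemma lin_lin_ext: "lin (lin_ext h)"
proof (rule linI)
  fix p q :: "'a \<Rightarrow>\<^sub>0 complex"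
  let ?A = "Poly_Mapping.keys p \<union> Poly_Mapping.keys q"
  have "Poly_Mapping.keys (p + q) \<subseteq> ?A"
    by (rule Poly_Mapping.keys_add)
  then show "lin_ext h (p + q) = lin_ext h p + lin_ext h q"
    by (simp add: lin_ext_superset[of ?A] lookup_add scale_add_left sum.distrib)
next
  fix c and p :: "'a \<Rightarrow>\<^sub>0 complex"
  have "Poly_Mapping.keys (scale c p) \<subseteq> Poly_Mapping.keys p"
    by (auto simp: in_keys_iff lookup_scale)
  then show "lin_ext h (scale c p) = scale c (lin_ext h p)"
    by (simp add: lin_ext_superset[of "Poly_Mapping.keys p"] lookup_scale scale_sum)
qed

lemma lin_ext_single [simp]: "lin_ext h (Poly_Mapping.single a x) = scale x (h a)"
  by (cases "x = 0") (simp_all add: lin_ext_def)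

lemma basis_expansion: "p = lin_ext (\<lambda>a. Poly_Mapping.single a 1) p"
  by (rule poly_mapping_eqI)
    (auto simp: lin_ext_def Poly_Mapping.lookup_sum lookup_single when_def in_keys_iff)

lemma lin_eqI:
  assumes "lin S" "lin T"
    and "\<And>a. S (Poly_Mapping.single a 1) = T (Poly_Mapping.single a 1)"
  shows "S p = T p"
proof -
  have "S (lin_ext (\<lambda>a. Poly_Mapping.single a 1) p) = T (lin_ext (\<lambda>a. Poly_Mapping.single a 1) p)"
    unfolding lin_ext_def using assms by (simp add: lin_sum lin_scale del: scale_simps)
  then show ?thesis
    by (simp flip: basis_expansion)
qed

section \<open>Exponentials of locally nilpotent operators\<close>

definition locally_nilpotent :: "(('a \<Rightarrow>\<^sub>0 complex) \<Rightarrow> ('a \<Rightarrow>\<^sub>0 complex)) \<Rightarrow> bool" where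
  "locally_nilpotent T \<longleftrightarrow> (\<forall>v. \<exists>N. (T ^^ N) v = 0)"

text \<open>
  For a linear operator a vanishing power stays zero, which turns the mere existence of an exponent
  into a bound beyond which the exponential series can be cut off.
\<close>

lemma locally_nilpotentE:
  assumes "lin T" "locally_nilpotent T"
  obtains N where "\<And>n. N \<le> n \<Longrightarrow> (T ^^ n) v = 0"
proof -
  obtain N where N: "(T ^^ N) v = 0"
    using assms by (auto simp: locally_nilpotent_def)
  have "(T ^^ n) v = 0" if "N \<le> n" for n
  proof -
    have "(T ^^ ((n - N) + N)) v = 0"
      unfolding funpow_add using N lin_zero[OF lin_funpow[OF assms(1)]] by simp
    with that show ?thesis by simp
  qed
  then show thesis by (rule that)
qed

lemma exp_op_eq_sum:
  assumes "\<And>n. N \<le> n \<Longrightarrow> (T ^^ n) v = 0"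
  shows "exp_op c T v = (\<Sum>m<N. scale (c ^ m / fact m) ((T ^^ m) v))"
  unfolding exp_op_def
  by (rule Sum_any.expand_superset) (use assms in \<open>auto simp flip: not_le\<close>)

text \<open>
  This one rule serves for the multiplication \<open>mu\<close>, which intertwines operators on the tensor square
  with operators on polynomials, and for the maps \<open>f \<mapsto> f \<otimes> g\<close> and \<open>g \<mapsto> f \<otimes> g\<close>.
\<close>

lemma exp_op_intertwine:
  assumes "lin R" "lin T" "locally_nilpotent T" and RT: "\<And>v. S (R v) = R (T v)"
  shows "exp_op c S (R v) = R (exp_op c T v)"
proof -
  obtain N where N: "\<And>n. N \<le> n \<Longrightarrow> (T ^^ n) v = 0"
    using locally_nilpotentE assms by blast
  have pow: "(S ^^ n) (R v) = R ((T ^^ n) v)" for n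
    by (induction n) (auto simp: RT)
  have "exp_op c S (R v) = (\<Sum>m<N. scale (c ^ m / fact m) ((S ^^ m) (R v)))"
    by (rule exp_op_eq_sum) (simp add: pow N lin_zero[OF assms(1)])
  also have "\<dots> = R (\<Sum>m<N. scale (c ^ m / fact m) ((T ^^ m) v))"
    using assms(1) by (simp add: pow lin_sum lin_scale)
  also have "\<dots> = R (exp_op c T v)"
    by (simp add: exp_op_eq_sum[OF N])
  finally show ?thesis .
qed

lemma funpow_commute_op: "(\<And>v. S (T v) = T (S v)) \<Longrightarrow> S ((T ^^ n) v) = (T ^^ n) (S v)"
  by (induction n) auto

lemma funpow_funpow_commute:
  "(\<And>v. S (T v) = T (S v)) \<Longrightarrow> (S ^^ m) ((T ^^ n) v) = (T ^^ n) ((S ^^ m) v)"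
  by (rule funpow_commute_op) (simp add: funpow_commute_op[of T S])

text \<open>
  The binomial theorem for commuting operators, divided by \<open>n!\<close> so that the coefficients become
  those of a product of two exponential series.
\<close>

lemma exp_coeff_plus_funpow:
  fixes c :: complex
  assumes S: "lin S" and T: "lin T" and comm: "\<And>v. S (T v) = T (S v)"
  shows "scale (1 / fact n) (((\<lambda>v. S v + T v) ^^ n) v) =
         (\<Sum>k\<le>n. scale (1 / (fact k * fact (n - k))) ((S ^^ k) ((T ^^ (n - k)) v)))"
proof -
  have "((\<lambda>v. S v + T v) ^^ n) v = (\<Sum>k\<le>n. scale (of_nat (n choose k)) ((S ^^ k) ((T ^^ (n - k)) v)))"
    (is "_ = ?B n")
  proof (induction n)
    case 0
    then show ?case by simp
  next
    case (Suc n)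
    let ?X = "\<lambda>k l. (S ^^ k) ((T ^^ l) v)"
    have SX: "S (?X k l) = ?X (Suc k) l" for k l by simp
    have TX: "T (?X k l) = ?X k (Suc l)" for k l
      using funpow_commute_op[of T S, OF comm[symmetric], of k] by simp
    \<comment> \<open>Applying \<open>S\<close> shifts the index \<open>k\<close> and applying \<open>T\<close> keeps it; splitting off \<open>k = 0\<close> from the
      second sum aligns the two, and Pascal's rule adds the coefficients.\<close>
    have "((\<lambda>v. S v + T v) ^^ Suc n) v = S (?B n) + T (?B n)"
      using Suc by simp
    also have "S (?B n) = (\<Sum>k\<le>n. scale (of_nat (n choose k)) (?X (Suc k) (n - k)))"
      using S by (simp add: lin_sum lin_scale)
    also have "T (?B n) = (\<Sum>k\<le>n. scale (of_nat (n choose k)) (?X k (Suc n - k)))"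
      unfolding lin_sum[OF T] lin_scale[OF T] TX by (rule sum.cong) (auto simp: Suc_diff_le)
    also have "\<dots> = (\<Sum>k\<le>Suc n. scale (of_nat (n choose k)) (?X k (Suc n - k)))"
      by (simp add: binomial_eq_0)
    also have "\<dots> = ?X 0 (Suc n) + (\<Sum>k\<le>n. scale (of_nat (n choose Suc k)) (?X (Suc k) (n - k)))"
      by (subst sum.atMost_Suc_shift) (simp del: sum.atMost_Suc)
    also have "(\<Sum>k\<le>n. scale (of_nat (n choose k)) (?X (Suc k) (n - k))) + \<dots> =
        ?X 0 (Suc n) + (\<Sum>k\<le>n. scale (of_nat (Suc n choose Suc k)) (?X (Suc k) (n - k)))"
      by (simp add: sum.distrib scale_add_left algebra_simps del: funpow.simps)
    also have "\<dots> = ?B (Suc n)"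
      by (subst sum.atMost_Suc_shift) (simp del: sum.atMost_Suc)
    finally show ?case .
  qed
  then have "scale (1 / fact n) (((\<lambda>v. S v + T v) ^^ n) v) =
     (\<Sum>k\<le>n. scale (1 / fact n * of_nat (n choose k)) ((S ^^ k) ((T ^^ (n - k)) v)))"
    by (simp add: scale_sum)
  also have "\<dots> = (\<Sum>k\<le>n. scale (1 / (fact k * fact (n - k))) ((S ^^ k) ((T ^^ (n - k)) v)))"
    by (rule sum.cong) (auto simp: binomial_fact field_simps)
  finally show ?thesis .
qed

text \<open>
  By the binomial theorem, the left side sums the terms \<open>c ^ (k + l) / (k! l!) S ^ k T ^ l v\<close> over
  a triangle \<open>k + l < N\<close> and the right side over a rectangle. Terms with large \<open>k\<close> vanish
  because \<open>S ^ k T ^ l v = T ^ l S ^ k v\<close>, and terms with large \<open>l\<close> trivially, so for \<open>N\<close> large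
  enough the triangle contains the rectangle and only zeros outside it.
\<close>

lemma exp_op_plus:
  assumes S: "lin S" "locally_nilpotent S" and T: "lin T" "locally_nilpotent T"
    and comm: "\<And>v. S (T v) = T (S v)"
  shows "exp_op c (\<lambda>v. S v + T v) v = exp_op c S (exp_op c T v)"
proof -
  obtain N1 where N1: "\<And>n. N1 \<le> n \<Longrightarrow> (S ^^ n) v = 0"
    using locally_nilpotentE[OF S] by blast
  obtain N2 where N2: "\<And>n. N2 \<le> n \<Longrightarrow> (T ^^ n) v = 0"
    using locally_nilpotentE[OF T] by blast
  define X where "X = (\<lambda>k l. (S ^^ k) ((T ^^ l) v))"
  define F where "F = (\<lambda>(k, l). scale (c ^ (k + l) / (fact k * fact l)) (X k l))"
  have X1: "X k l = 0" if "N1 \<le> k" for k l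
    using that funpow_funpow_commute[of S T, OF comm]
    by (simp add: X_def N1 lin_zero[OF lin_funpow[OF T(1)]])
  have X2: "X k l = 0" if "N2 \<le> l" for k l
    using that by (simp add: X_def N2 lin_zero[OF lin_funpow[OF S(1)]])
  have diag: "scale (c ^ n / fact n) (((\<lambda>v. S v + T v) ^^ n) v) = (\<Sum>k\<le>n. F (k, n - k))" for n
  proof -
    have "scale (c ^ n / fact n) (((\<lambda>v. S v + T v) ^^ n) v) =
        scale (c ^ n) (scale (1 / fact n) (((\<lambda>v. S v + T v) ^^ n) v))"
      by simp
    also have "\<dots> = (\<Sum>k\<le>n. F (k, n - k))"
      unfolding exp_coeff_plus_funpow[OF S(1) T(1) comm] scale_sum
      by (auto simp: F_def X_def intro!: sum.cong)
    finally show ?thesis .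
  qed
  have supp: "k < N1 \<and> l < N2" if "F (k, l) \<noteq> 0" for k l
    using that X1[of k l] X2[of l k] by (auto simp: F_def simp flip: not_le)
  \<comment> \<open>If \<open>k + l\<close> is at least \<open>N1 + N2\<close>, then \<open>N1 \<le> k\<close> or \<open>N2 \<le> l\<close>.\<close>
  have vanish: "((\<lambda>v. S v + T v) ^^ n) v = 0" if "N1 + N2 \<le> n" for n
  proof -
    have "X k (n - k) = 0" if "k \<le> n" for k
      using that \<open>N1 + N2 \<le> n\<close> X1[of k "n - k"] X2[of "n - k" k] by linarith
    then have "scale (1 / fact n) (((\<lambda>v. S v + T v) ^^ n) v) = 0"
      unfolding exp_coeff_plus_funpow[OF S(1) T(1) comm] by (simp add: X_def)
    from arg_cong[OF this, of "scale (fact n)"] show ?thesis by simp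
  qed
  have expT: "exp_op c T v = (\<Sum>l<N2. scale (c ^ l / fact l) ((T ^^ l) v))"
    by (rule exp_op_eq_sum) (rule N2)
  have "exp_op c (\<lambda>v. S v + T v) v = (\<Sum>n<N1 + N2. \<Sum>k\<le>n. F (k, n - k))"
    unfolding diag[symmetric] by (rule exp_op_eq_sum) (rule vanish)
  also have "\<dots> = (\<Sum>(k, l)\<in>{(k, l). k + l < N1 + N2}. F (k, l))"
    by (rule sum.triangle_reindex[symmetric])
  also have "\<dots> = (\<Sum>(k, l)\<in>{..<N1} \<times> {..<N2}. F (k, l))"
    by (rule sum.mono_neutral_right)
      (auto dest: supp intro: finite_subset[of _ "{..<N1 + N2} \<times> {..<N1 + N2}"])
  also have "\<dots> = (\<Sum>k<N1. \<Sum>l<N2. F (k, l))"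
    by (simp add: sum.cartesian_product)
  also have "\<dots> = (\<Sum>k<N1. scale (c ^ k / fact k) ((S ^^ k) (exp_op c T v)))"
    unfolding expT
    by (simp add: lin_sum[OF lin_funpow[OF S(1)]] lin_scale[OF lin_funpow[OF S(1)]]
        scale_sum F_def X_def power_add)
  also have "\<dots> = exp_op c S (exp_op c T v)"
  proof (rule exp_op_eq_sum[symmetric])
    fix n assume "N1 \<le> n"
    then show "(S ^^ n) (exp_op c T v) = 0"
      unfolding expT
      using X1[of n]
      by (simp add: lin_sum[OF lin_funpow[OF S(1)]] lin_scale[OF lin_funpow[OF S(1)]] X_def)
  qed
  finally show ?thesis .
qed

text \<open>
  Since \<open>exp (- c T) = exp (c (- T))\<close> and \<open>T\<close> commutes with \<open>- T\<close>, the product is the exponential of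
  \<open>T + (- T) = 0\<close>.
\<close>

lemma exp_op_cancel:
  assumes T: "lin T" "locally_nilpotent T"
  shows "exp_op c T (exp_op (- c) T v) = v"
proof -
  let ?U = "\<lambda>v. scale (- 1) (T v)"
  have U: "lin ?U"
    using T by (auto intro!: linI simp: lin_add lin_scale scale_add_right)
  have pow: "(?U ^^ m) v = scale ((- 1) ^ m) ((T ^^ m) v)" for m v
    by (induction m) (auto simp: lin_scale[OF T(1)])
  have nil: "locally_nilpotent ?U"
    using T(2) unfolding locally_nilpotent_def pow by (metis scale_simps(3))
  have "exp_op (- c) T v = exp_op c ?U v"
    unfolding exp_op_def pow by (simp add: power_minus[of c] mult.commute)
  then have "exp_op c T (exp_op (- c) T v) = exp_op c (\<lambda>v. T v + ?U v) v"
    using exp_op_plus[OF T U nil] by (simp add: lin_scale[OF T(1)])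
  also have "(\<lambda>v. T v + ?U v) = (\<lambda>v. 0)"
    using scale_add_left[of 1 "- 1"] by auto
  also have "exp_op c (\<lambda>v. 0 :: 'a \<Rightarrow>\<^sub>0 complex) v = v"
  proof -
    have "((\<lambda>v. 0 :: 'a \<Rightarrow>\<^sub>0 complex) ^^ n) v = 0" if "1 \<le> n" for n
      using that by (cases n) auto
    from exp_op_eq_sum[OF this, where c = c] show ?thesis by simp
  qed
  finally show ?thesis .
qed

section \<open>Operators that lower a weight\<close>

text \<open>
  \<open>T\<close> maps the span of the basis vectors of weight at most \<open>n\<close> into the span of those of weight
  less than \<open>n\<close>. Formulated on these filtration steps rather than on single basis vectors, the
  property passes at once to sums and compositions. For \<open>n = 0\<close> it says that \<open>T\<close> annihilates the
  vectors of weight \<open>0\<close>.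
\<close>

definition lowers :: "('a \<Rightarrow> nat) \<Rightarrow> (('a \<Rightarrow>\<^sub>0 complex) \<Rightarrow> ('a \<Rightarrow>\<^sub>0 complex)) \<Rightarrow> bool" where
  "lowers w T \<longleftrightarrow> (\<forall>n p. (\<forall>a\<in>Poly_Mapping.keys p. w a < Suc n) \<longrightarrow> (\<forall>a\<in>Poly_Mapping.keys (T p). w a < n))"

lemma lowers_locally_nilpotent:
  assumes "lowers w T"
  shows "locally_nilpotent T"
  unfolding locally_nilpotent_def
proof
  fix v :: "'a \<Rightarrow>\<^sub>0 complex"
  have "(T ^^ n) p = 0" if "\<forall>a\<in>Poly_Mapping.keys p. w a < n" for n p
    using that
  proof (induction n arbitrary: p)
    case 0
    then show ?case by simp
  next
    case (Suc n)
    then have "\<forall>a\<in>Poly_Mapping.keys (T p). w a < n"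
      using assms by (auto simp: lowers_def)
    then show ?case
      using Suc.IH by (simp add: funpow_Suc_right del: funpow.simps)
  qed
  moreover have "\<forall>a\<in>Poly_Mapping.keys v. w a < Suc (\<Sum>a\<in>Poly_Mapping.keys v. w a)"
    by (auto simp: less_Suc_eq_le intro: member_le_sum)
  ultimately show "\<exists>N. (T ^^ N) v = 0" by blast
qed

lemma lowersI:
  assumes "\<And>n p b. \<forall>a\<in>Poly_Mapping.keys p. w a < Suc n \<Longrightarrow> b \<in> Poly_Mapping.keys (T p) \<Longrightarrow> w b < n"
  shows "lowers w T"
  unfolding lowers_def by (intro allI impI ballI) (rule assms)

lemma lowersD:
  assumes "lowers w T" "\<forall>a\<in>Poly_Mapping.keys p. w a < Suc n"
  shows "\<forall>b\<in>Poly_Mapping.keys (T p). w b < n"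
  using assms unfolding lowers_def by simp

lemma lowers_comp:
  assumes "lowers w S" "lowers w T"
  shows "lowers w (\<lambda>p. S (T p))"
proof (rule lowersI)
  fix n p b
  assume "\<forall>a\<in>Poly_Mapping.keys p. w a < Suc n" and b: "b \<in> Poly_Mapping.keys (S (T p))"
  then have "\<forall>a\<in>Poly_Mapping.keys (T p). w a < Suc n"
    using lowersD[OF assms(2)] less_SucI by blast
  with b show "w b < n"
    using lowersD[OF assms(1)] by simp
qed

lemma lowers_plus:
  assumes "lowers w S" "lowers w T"
  shows "lowers w (\<lambda>p. S p + T p)"
proof (rule lowersI)
  fix n p b
  assume p: "\<forall>a\<in>Poly_Mapping.keys p. w a < Suc n" and b: "b \<in> Poly_Mapping.keys (S p + T p)"
  have "b \<in> Poly_Mapping.keys (S p) \<union> Poly_Mapping.keys (T p)"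
    by (rule subsetD[OF Poly_Mapping.keys_add b])
  then show "w b < n"
    using lowersD[OF assms(1) p] lowersD[OF assms(2) p] by blast
qed

lemma lowers_Sum: "(\<And>i. i \<in> I \<Longrightarrow> lowers w (T i)) \<Longrightarrow> lowers w (\<lambda>p. \<Sum>i\<in>I. T i p)"
proof (induction I rule: infinite_finite_induct)
  case (insert x F)
  then show ?case using lowers_plus[of w "T x"] by simp
qed (simp_all add: lowers_def)

lemma lowers_lin_ext:
  assumes "\<And>a b. b \<in> Poly_Mapping.keys (h a) \<Longrightarrow> w b < w a"
  shows "lowers w (lin_ext h)"
  unfolding lowers_def
proof (intro allI impI ballI)
  fix n p b
  assume p: "\<forall>a\<in>Poly_Mapping.keys p. w a < Suc n" and b: "b \<in> Poly_Mapping.keys (lin_ext h p)"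
  obtain a where "a \<in> Poly_Mapping.keys p" "b \<in> Poly_Mapping.keys (h a)"
  proof -
    from b have "(\<Sum>a\<in>Poly_Mapping.keys p. Poly_Mapping.lookup p a * Poly_Mapping.lookup (h a) b) \<noteq> 0"
      by (simp add: lin_ext_def in_keys_iff Poly_Mapping.lookup_sum lookup_scale)
    then obtain a where "a \<in> Poly_Mapping.keys p" "Poly_Mapping.lookup p a * Poly_Mapping.lookup (h a) b \<noteq> 0"
      by (rule sum.not_neutral_contains_not_neutral)
    then show thesis using that by (auto simp: in_keys_iff)
  qed
  with p assms show "w b < n" by (metis less_Suc_eq_le order_less_le_trans)
qed

lemma lowers_single:
  assumes "lowers w T" "b \<in> Poly_Mapping.keys (T (Poly_Mapping.single a 1))"
  shows "w b < w a"
  using assms unfolding lowers_def by (metis keys_single lessI empty_iff insert_iff)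

section \<open>Partial derivatives\<close>

lemma lin_pderivative: "lin (pderivative v)"
  unfolding pderivative_def by (rule lin_lin_ext)

lemma pderivative_single:
  "pderivative v (Poly_Mapping.single a x) =
     Poly_Mapping.single (a - Poly_Mapping.single v 1) (x * of_nat (Poly_Mapping.lookup a v))"
  by (simp add: pderivative_def)

text \<open>
  Exponents are natural numbers and their subtraction truncates, so this step of the Leibniz rule is
  valid only when the variable occurs in the monomial; otherwise the coefficient of the
  corresponding term vanishes.
\<close>

lemma diff_single_add:
  fixes a b :: "'v \<Rightarrow>\<^sub>0 nat"
  assumes "Poly_Mapping.lookup a v \<noteq> 0"
  shows "a + b - Poly_Mapping.single v 1 = (a - Poly_Mapping.single v 1) + b"
  using assms by (intro poly_mapping_eqI) (auto simp: lookup_add lookup_minus lookup_single when_def)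

lemma pderivative_commute: "pderivative u (pderivative v p) = pderivative v (pderivative u p)"
proof (rule lin_eqI[where p = p])
  show "lin (\<lambda>p. pderivative u (pderivative v p))" "lin (\<lambda>p. pderivative v (pderivative u p))"
    by (rule lin_comp[OF lin_pderivative lin_pderivative])+
next
  fix a :: "'a mon"
  show "pderivative u (pderivative v (Poly_Mapping.single a 1)) =
        pderivative v (pderivative u (Poly_Mapping.single a 1))"
    by (cases "u = v")
      (simp_all add: pderivative_single lookup_minus lookup_single diff_right_commute mult.commute)
qed

lemma lin_mult_left: "lin (\<lambda>p :: 'n cpoly. p * q)" and lin_mult_right: "lin (\<lambda>q :: 'n cpoly. p * q)"
proof -
  have sc: "scale c r = Poly_Mapping.single 0 c * r" for c and r :: "'n cpoly"
    unfolding scale_def by (rule Poly_Mapping.mult_map_scale_conv_mult)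
  show "lin (\<lambda>p :: 'n cpoly. p * q)" "lin (\<lambda>q :: 'n cpoly. p * q)"
    by (auto intro!: linI simp: sc algebra_simps)
qed

text \<open>
  Both sides are bilinear, so it suffices to compare them on monomials, where the exponent of \<open>v\<close> in
  the product is the sum of the two exponents.
\<close>

lemma pderivative_mult: "pderivative v (p * q) = pderivative v p * q + p * pderivative v q"
proof (rule lin_eqI[where p = p])
  show "lin (\<lambda>p. pderivative v (p * q))"
    by (rule lin_comp[OF lin_pderivative lin_mult_left])
  show "lin (\<lambda>p. pderivative v p * q + p * pderivative v q)"
    by (intro lin_plus lin_mult_left lin_comp[OF lin_mult_left lin_pderivative])
next
  fix a :: "'a mon"
  let ?A = "Poly_Mapping.single a (1 :: complex)"
  show "pderivative v (?A * q) = pderivative v ?A * q + ?A * pderivative v q"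
  proof (rule lin_eqI[where p = q])
    show "lin (\<lambda>q. pderivative v (?A * q))"
      by (rule lin_comp[OF lin_pderivative lin_mult_right])
    show "lin (\<lambda>q. pderivative v ?A * q + ?A * pderivative v q)"
      by (intro lin_plus lin_mult_right lin_comp[OF lin_mult_right lin_pderivative])
  next
    fix b :: "'a mon"
    have "a + b - Poly_Mapping.single v 1 = (a - Poly_Mapping.single v 1) + b"
      if "Poly_Mapping.lookup a v \<noteq> 0"
      using diff_single_add[OF that] .
    moreover have "a + b - Poly_Mapping.single v 1 = a + (b - Poly_Mapping.single v 1)"
      if "Poly_Mapping.lookup b v \<noteq> 0"
      using diff_single_add[OF that, of a] by (simp add: add.commute)
    ultimately show "pderivative v (?A * Poly_Mapping.single b 1) =
        pderivative v ?A * Poly_Mapping.single b 1 + ?A * pderivative v (Poly_Mapping.single b 1)"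
      by (cases "Poly_Mapping.lookup a v = 0"; cases "Poly_Mapping.lookup b v = 0")
        (simp_all add: mult_single pderivative_single lookup_add flip: single_add)
  qed
qed

definition mdeg :: "'n mon \<Rightarrow> nat" where
  "mdeg a = (\<Sum>v\<in>Poly_Mapping.keys a. Poly_Mapping.lookup a v)"

lemma mdeg_diff_single_less:
  assumes "Poly_Mapping.lookup a v \<noteq> 0"
  shows "mdeg (a - Poly_Mapping.single v 1) < mdeg a"
proof -
  have "mdeg (a - Poly_Mapping.single v 1) =
      (\<Sum>u\<in>Poly_Mapping.keys a. Poly_Mapping.lookup (a - Poly_Mapping.single v 1) u)"
    unfolding mdeg_def
    by (rule sum.mono_neutral_left) (auto simp: in_keys_iff lookup_minus)
  also have "\<dots> < mdeg a"
    unfolding mdeg_def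
    by (rule sum_strict_mono_ex1)
      (use assms in \<open>auto simp: lookup_minus lookup_single when_def in_keys_iff intro!: bexI[of _ v]\<close>)
  finally show ?thesis .
qed

lemma lowers_pderivative: "lowers mdeg (pderivative v)"
  unfolding pderivative_def
  by (rule lowers_lin_ext) (auto split: if_splits intro: mdeg_diff_single_less[unfolded One_nat_def])

lemma lin_Lam: "lin Lam"
  unfolding Lam_def[abs_def] by (rule lin_Sum) (rule lin_comp[OF lin_pderivative lin_pderivative])

lemma lowers_Lam: "lowers mdeg Lam"
  unfolding Lam_def[abs_def] by (rule lowers_Sum) (rule lowers_comp[OF lowers_pderivative lowers_pderivative])

lemma Lam_pderivative: "Lam (pderivative v p) = pderivative v (Lam p)"
  unfolding Lam_def by (simp add: lin_sum[OF lin_pderivative] pderivative_commute[of v])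

section \<open>The tensor square\<close>

lemma tensor_eq_lin_ext:
  "tensor f g = lin_ext (\<lambda>a. lin_ext (\<lambda>b. Poly_Mapping.single (a, b) 1) g) f"
  by (simp add: tensor_def lin_ext_def scale_sum)

lemma lin_tensor_left: "lin (\<lambda>f. tensor f g)"
  unfolding tensor_eq_lin_ext by (rule lin_lin_ext)

lemma lin_tensor_right: "lin (\<lambda>g. tensor f g)"
  unfolding tensor_eq_lin_ext lin_ext_def[of _ f]
  by (rule lin_Sum) (auto intro!: linI simp: lin_add[OF lin_lin_ext] lin_scale[OF lin_lin_ext] scale_add_right mult.commute)

lemma tensor_single: "tensor (Poly_Mapping.single a 1) (Poly_Mapping.single b 1) = Poly_Mapping.single (a, b) 1"
  by (simp add: tensor_eq_lin_ext)

lemma keys_tensor: "Poly_Mapping.keys (tensor f g) \<subseteq> Poly_Mapping.keys f \<times> Poly_Mapping.keys g"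
  unfolding tensor_def
  by (intro order_trans[OF Poly_Mapping.keys_sum] UN_least) auto

text \<open>
  Every basis vector of the tensor square is a pure tensor, so identities between operators need only
  be checked on pure tensors.
\<close>

lemma lin_tensor_eqI:
  assumes "lin S" "lin T" and "\<And>f g. S (tensor f g) = T (tensor f g)"
  shows "S p = T p"
  by (rule lin_eqI[OF assms(1,2)]) (metis assms(3) tensor_single surj_pair)

lemma bilin_eqI:
  assumes "\<And>g. lin (\<lambda>f. B f g)" "\<And>f. lin (B f)" "\<And>g. lin (\<lambda>f. C f g)" "\<And>f. lin (C f)"
    and "\<And>a b. B (Poly_Mapping.single a 1) (Poly_Mapping.single b 1) = C (Poly_Mapping.single a 1) (Poly_Mapping.single b 1)"
  shows "B f g = C f g"
  by (rule lin_eqI[of "\<lambda>f. B f g" "\<lambda>f. C f g"], rule assms, rule assms,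
      rule lin_eqI[of "B _" "C _"]) (rule assms)+

lemma lin_tensor_op: "lin (tensor_op S T)"
  unfolding tensor_op_def by (rule lin_lin_ext)

lemma tensor_op_tensor:
  assumes "lin S" "lin T"
  shows "tensor_op S T (tensor f g) = tensor (S f) (T g)"
  by (rule bilin_eqI[of "\<lambda>f g. tensor_op S T (tensor f g)" "\<lambda>f g. tensor (S f) (T g)"])
    (auto intro!: lin_comp[OF lin_tensor_op lin_tensor_left] lin_comp[OF lin_tensor_op lin_tensor_right]
      lin_comp[OF lin_tensor_left assms(1)] lin_comp[OF lin_tensor_right assms(2)]
      simp: tensor_single, simp add: tensor_op_def)

lemma lin_mu: "lin mu"
  unfolding mu_def by (rule lin_lin_ext)

lemma mu_tensor: "mu (tensor f g) = f * g"
  by (rule bilin_eqI[of "\<lambda>f g. mu (tensor f g)" "\<lambda>f g. f * g"])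
    (auto intro!: lin_comp[OF lin_mu lin_tensor_left] lin_comp[OF lin_mu lin_tensor_right]
      lin_mult_left lin_mult_right simp: tensor_single, simp add: mu_def)

abbreviation mdeg2 :: "'n mon \<times> 'n mon \<Rightarrow> nat" where
  "mdeg2 \<equiv> \<lambda>(a, b). mdeg a + mdeg b"

text \<open>
  Total degree drops as soon as one factor lowers the degree and the other does not raise it; this
  covers both \<open>Lam \<otimes> 1\<close> and the summands of \<open>Omega\<close>.
\<close>

lemma lowers_tensor_op:
  assumes "\<And>a b. b \<in> Poly_Mapping.keys (S (Poly_Mapping.single a 1)) \<Longrightarrow> mdeg b \<le> mdeg a"
    and "\<And>a b. b \<in> Poly_Mapping.keys (T (Poly_Mapping.single a 1)) \<Longrightarrow> mdeg b \<le> mdeg a"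
    and "lowers mdeg S \<or> lowers mdeg T"
  shows "lowers mdeg2 (tensor_op S T)"
  unfolding tensor_op_def
proof (rule lowers_lin_ext, clarsimp)
  fix a b a' b'
  assume "(a', b') \<in> Poly_Mapping.keys (tensor (S (Poly_Mapping.single a 1)) (T (Poly_Mapping.single b 1)))"
  then have "a' \<in> Poly_Mapping.keys (S (Poly_Mapping.single a 1))" "b' \<in> Poly_Mapping.keys (T (Poly_Mapping.single b 1))"
    using keys_tensor by blast+
  with assms lowers_single show "mdeg a' + mdeg b' < mdeg a + mdeg b"
    by (metis add_le_less_mono add_less_le_mono)
qed

definition Lam_l :: "'n::finite cpoly2 \<Rightarrow> 'n cpoly2" where
  "Lam_l = tensor_op Lam (\<lambda>p. p)"

definition Lam_r :: "'n::finite cpoly2 \<Rightarrow> 'n cpoly2" where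
  "Lam_r = tensor_op (\<lambda>p. p) Lam"

lemma lin_Lam_l: "lin Lam_l" and lin_Lam_r: "lin Lam_r" and lin_Omega: "lin Omega"
  unfolding Lam_l_def Lam_r_def Omega_def[abs_def]
  by (intro lin_Sum lin_plus lin_tensor_op)+

lemma lowers_Lam_l: "lowers mdeg2 Lam_l" and lowers_Lam_r: "lowers mdeg2 Lam_r"
  and lowers_Omega: "lowers mdeg2 Omega"
  unfolding Lam_l_def Lam_r_def Omega_def[abs_def]
  by (auto intro!: lowers_Sum lowers_plus lowers_tensor_op lowers_Lam lowers_pderivative
      intro: less_imp_le lowers_single[OF lowers_Lam] lowers_single[OF lowers_pderivative])

lemma Lam_l_tensor: "Lam_l (tensor f g) = tensor (Lam f) g"
  and Lam_r_tensor: "Lam_r (tensor f g) = tensor f (Lam g)"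
  by (simp_all add: Lam_l_def Lam_r_def tensor_op_tensor lin_Lam lin_id)

lemma Omega_tensor:
  "Omega (tensor f g) = (\<Sum>i\<in>UNIV. tensor (del_z i f) (del_xi i g) + tensor (del_xi i f) (del_z i g))"
  by (simp add: Omega_def tensor_op_tensor lin_pderivative)

lemma Lam_l_Lam_r: "Lam_l (Lam_r w) = Lam_r (Lam_l w)"
  by (rule lin_tensor_eqI[OF lin_comp[OF lin_Lam_l lin_Lam_r] lin_comp[OF lin_Lam_r lin_Lam_l]])
    (simp_all add: lin_Lam_l lin_Lam_r Lam_l_tensor Lam_r_tensor)

text \<open>
  On a pure tensor both sides are sums of tensors of iterated partial derivatives, which agree
  because partial derivatives commute. The same holds for the other factor.
\<close>

lemma Lam_l_Omega: "Lam_l (Omega w) = Omega (Lam_l w)"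
  by (rule lin_tensor_eqI[OF lin_comp[OF lin_Lam_l lin_Omega] lin_comp[OF lin_Omega lin_Lam_l]])
    (simp_all add: lin_Lam_l lin_Omega Lam_l_tensor Omega_tensor lin_sum[OF lin_Lam_l]
      lin_add[OF lin_Lam_l] Lam_pderivative)

lemma Lam_r_Omega: "Lam_r (Omega w) = Omega (Lam_r w)"
  by (rule lin_tensor_eqI[OF lin_comp[OF lin_Lam_r lin_Omega] lin_comp[OF lin_Omega lin_Lam_r]])
    (simp_all add: lin_Lam_r lin_Omega Lam_r_tensor Omega_tensor lin_sum[OF lin_Lam_r]
      lin_add[OF lin_Lam_r] Lam_pderivative)

text \<open>
  By the Leibniz rule,
  \<open>\<delta>\<^sub>i \<partial>\<^sub>i (f g) = (\<delta>\<^sub>i \<partial>\<^sub>i f) g + f (\<delta>\<^sub>i \<partial>\<^sub>i g) + \<partial>\<^sub>i f \<cdot> \<delta>\<^sub>i g + \<delta>\<^sub>i f \<cdot> \<partial>\<^sub>i g\<close>; summed over \<open>i\<close>, the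
  first two terms give \<open>Lam \<otimes> 1\<close> and \<open>1 \<otimes> Lam\<close>, and the mixed ones give \<open>Omega\<close>.
\<close>

lemma Lam_mu: "Lam (mu w) = mu (Lam_l w + Lam_r w + Omega w)"
proof (rule lin_tensor_eqI[of "\<lambda>w. Lam (mu w)"])
  show "lin (\<lambda>w. Lam (mu w))"
    by (intro lin_comp[OF lin_Lam lin_mu])
  show "lin (\<lambda>w. mu (Lam_l w + Lam_r w + Omega w))"
    by (intro lin_comp[OF lin_mu] lin_plus lin_Lam_l lin_Lam_r lin_Omega)
  show "Lam (mu (tensor f g)) = mu (Lam_l (tensor f g) + Lam_r (tensor f g) + Omega (tensor f g))" for f g
    by (simp add: Lam_l_tensor Lam_r_tensor Omega_tensor lin_add[OF lin_mu] lin_sum[OF lin_mu] mu_tensor)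
      (simp add: Lam_def pderivative_mult lin_add[OF lin_pderivative] sum.distrib
        sum_distrib_left sum_distrib_right algebra_simps)
qed

section \<open>The isomorphism of algebras\<close>

text \<open>
  The star product starts with \<open>exp (- t Omega)\<close>, which is exactly what cancels the mixed part of
  \<open>exp (t Lam)\<close> when that operator is moved across \<open>mu\<close>.
\<close>

lemma Phi_star: "Phi t (star t f g) = Phi t f * Phi t g"
proof -
  let ?K = "\<lambda>w. Lam_l w + Lam_r w"
  let ?w = "exp_op (- t) Omega (tensor f g)"
  note nil = lowers_locally_nilpotent
  have K: "lin ?K" "lowers mdeg2 ?K"
    by (intro lin_plus lin_Lam_l lin_Lam_r lowers_plus lowers_Lam_l lowers_Lam_r)+
  have M: "lin (\<lambda>w. ?K w + Omega w)" "lowers mdeg2 (\<lambda>w. ?K w + Omega w)"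
    by (rule lin_plus[OF K(1) lin_Omega] lowers_plus[OF K(2) lowers_Omega])+
  have "Phi t (star t f g) = mu (exp_op t (\<lambda>w. ?K w + Omega w) ?w)"
    unfolding Phi_def star_def
    by (rule exp_op_intertwine[where T = "\<lambda>w. ?K w + Omega w"])
      (rule lin_mu M(1) nil[OF M(2)] Lam_mu)+
  also have "\<dots> = mu (exp_op t ?K (exp_op t Omega ?w))"
    by (subst exp_op_plus[OF K(1) nil[OF K(2)] lin_Omega nil[OF lowers_Omega]])
      (simp_all add: Lam_l_Omega Lam_r_Omega lin_add[OF lin_Omega])
  also have "exp_op t Omega ?w = tensor f g"
    by (rule exp_op_cancel[OF lin_Omega nil[OF lowers_Omega]])
  also have "exp_op t ?K (tensor f g) = exp_op t Lam_l (exp_op t Lam_r (tensor f g))"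
    by (rule exp_op_plus[OF lin_Lam_l nil[OF lowers_Lam_l] lin_Lam_r nil[OF lowers_Lam_r] Lam_l_Lam_r])
  also have "exp_op t Lam_r (tensor f g) = tensor f (Phi t g)"
    unfolding Phi_def
    by (rule exp_op_intertwine[OF lin_tensor_right lin_Lam nil[OF lowers_Lam] Lam_r_tensor])
  also have "exp_op t Lam_l (tensor f (Phi t g)) = tensor (Phi t f) (Phi t g)"
    unfolding Phi_def
    by (rule exp_op_intertwine[OF lin_tensor_left lin_Lam nil[OF lowers_Lam] Lam_l_tensor])
  finally show ?thesis
    by (simp add: mu_tensor)
qed

text \<open>
  Surjectivity is what makes the Hilbert-choice inverse a right inverse; \<open>Phi (- t) g\<close> is a
  preimage of \<open>g\<close>.
\<close>

lemma Phi_inv: "Phi t (inv (Phi t) g) = g"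
proof (rule surj_f_inv_f)
  have "Phi t (Phi (- t) g) = g" for g :: "'a cpoly"
    unfolding Phi_def by (rule exp_op_cancel[OF lin_Lam lowers_locally_nilpotent[OF lowers_Lam]])
  then show "surj (Phi t :: 'a cpoly \<Rightarrow> 'a cpoly)"
    by (metis surjI)
qed

theorem proposition2p13:
  fixes t :: complex and f :: "'n::finite cpoly"
  shows "Phi_push t (mult_op (star t) f) = mult_op (*) (Phi t f)"
  by (simp add: Phi_push_def weyl_algebra.mult fun_eq_iff) (simp add: mult_op_def Phi_star Phi_inv)

end
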